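(* Let $h>0$ be an integer, and let $T=(V,E)$ be an arbitrary finite tree of height $h$ rooted at $r$, with $\Lambda$ its set of vertices at distance $h$ from $r$. Let $\beta>0$, let $\phi$ be a distribution on $\mathbb{R}$, and let $\mu=\mu_{\beta,\phi}$ be the random Gibbs distribution on $T$. Then for every function $G:\{\pm1\}^\Lambda\to\mathbb{R}$, $$\mathbb{E}\big[\|\mu^+_\Lambda-\mu^-_\Lambda\|_{\rm TV}\big]\ge\frac{\big(\mathbb{E}\big[\langle G\rangle_{\mu^+_\Lambda}-\langle G\rangle_{\mu^-_\Lambda}\big]\big)^2}{4\,\mathbb{E}\big[\langle G^2\rangle_{\mu}\big]},$$ where $\mathbb{E}$ is the expectation over the couplings $\{J_e\}$.
   Context: Let $\{J_e\}_{e\in E}$ be i.i.d. with law $\phi$. Then $$\mu(\sigma)\propto\exp\Big(\beta\sum_{\{u,w\}\in E}\mathbf{1}\{\sigma(u)=\sigma(w)\}J_{\{u,w\}}\Big),\qquad\sigma\in\{\pm1\}^V.$$ For $s\in\{\pm1\}$, $\mu^s_\Lambda$ is the marginal of $\mu$ on $\Lambda$ conditioned on $\sigma(r)=s$. For a measure $\nu$, $\langle G\rangle_\nu$ denotes the expectation of $G$ under $\nu$. Also $\langle G^2\rangle_\mu=\sum_\sigma\mu(\sigma)G(\sigma(\Lambda))^2$. *)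

theory Defs
  imports "HOL-Probability.Probability"
begin

text \<open>Graphs are undirected, an edge being a two-element set of vertices. Walks and cycles are
  lists of vertices; the closing edge of a cycle runs from its last to its first vertex.\<close>

definition simple_graph :: "'v set \<Rightarrow> 'v set set \<Rightarrow> bool" where
  "simple_graph V E \<longleftrightarrow> finite V \<and> (\<forall>e\<in>E. e \<subseteq> V \<and> card e = 2)"

definition walk_betw :: "'v set set \<Rightarrow> 'v \<Rightarrow> 'v list \<Rightarrow> 'v \<Rightarrow> bool" where
  "walk_betw E u p v \<longleftrightarrow>
     p \<noteq> [] \<and> hd p = u \<and> last p = v \<and> successively (\<lambda>x y. {x, y} \<in> E) p"

definition cycle_in :: "'v set set \<Rightarrow> 'v list \<Rightarrow> bool" where
  "cycle_in E c \<longleftrightarrow> length c \<ge> 3 \<and> distinct c \<and>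
     successively (\<lambda>x y. {x, y} \<in> E) c \<and> {last c, hd c} \<in> E"

definition rooted_tree :: "'v set \<Rightarrow> 'v set set \<Rightarrow> 'v \<Rightarrow> bool" where
  "rooted_tree V E r \<longleftrightarrow> simple_graph V E \<and> r \<in> V \<and>
     (\<forall>u\<in>V. \<forall>v\<in>V. \<exists>p. walk_betw E u p v) \<and> (\<nexists>c. cycle_in E c)"

definition graph_dist :: "'v set set \<Rightarrow> 'v \<Rightarrow> 'v \<Rightarrow> nat" where
  "graph_dist E u v = (LEAST n. \<exists>p. walk_betw E u p v \<and> length p = Suc n)"

definition tree_height :: "'v set \<Rightarrow> 'v set set \<Rightarrow> 'v \<Rightarrow> nat" where
  "tree_height V E r = Max (graph_dist E r ` V)"

definition tree_level :: "'v set \<Rightarrow> 'v set set \<Rightarrow> 'v \<Rightarrow> nat \<Rightarrow> 'v set" where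
  "tree_level V E r n = {v \<in> V. graph_dist E r v = n}"

definition spin_configs :: "'v set \<Rightarrow> ('v \<Rightarrow> int) set" where
  "spin_configs V = V \<rightarrow>\<^sub>E {-1, 1}"

definition gibbs_weight ::
    "'v set set \<Rightarrow> real \<Rightarrow> ('v set \<Rightarrow> real) \<Rightarrow> ('v \<Rightarrow> int) \<Rightarrow> real" where
  "gibbs_weight E \<beta> J \<sigma> = exp (\<beta> * (\<Sum>e\<in>E. of_bool (\<forall>u\<in>e. \<forall>w\<in>e. \<sigma> u = \<sigma> w) * J e))"

definition partition_function :: "'v set \<Rightarrow> 'v set set \<Rightarrow> real \<Rightarrow> ('v set \<Rightarrow> real) \<Rightarrow> real" where
  "partition_function V E \<beta> J = (\<Sum>\<sigma>\<in>spin_configs V. gibbs_weight E \<beta> J \<sigma>)"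

definition gibbs ::
    "'v set \<Rightarrow> 'v set set \<Rightarrow> real \<Rightarrow> ('v set \<Rightarrow> real) \<Rightarrow> ('v \<Rightarrow> int) pmf" where
  "gibbs V E \<beta> J = embed_pmf (\<lambda>\<sigma>.
     if \<sigma> \<in> spin_configs V then gibbs_weight E \<beta> J \<sigma> / partition_function V E \<beta> J else 0)"

definition gibbs_cond_marginal ::
    "'v set \<Rightarrow> 'v set set \<Rightarrow> real \<Rightarrow> ('v set \<Rightarrow> real) \<Rightarrow> 'v \<Rightarrow> int \<Rightarrow> 'v set \<Rightarrow> ('v \<Rightarrow> int) pmf" where
  "gibbs_cond_marginal V E \<beta> J r s \<Lambda> =
     map_pmf (\<lambda>\<sigma>. restrict \<sigma> \<Lambda>) (cond_pmf (gibbs V E \<beta> J) {\<sigma>. \<sigma> r = s})"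

text \<open>Every subset of a \<open>pmf\<close>'s underlying type is an event, so the supremum is over all sets.\<close>

definition tv_dist :: "'a pmf \<Rightarrow> 'a pmf \<Rightarrow> real" where
  "tv_dist p q = (SUP A. \<bar>measure_pmf.prob p A - measure_pmf.prob q A\<bar>)"

lemma finite_spin_configs: "finite V \<Longrightarrow> finite (spin_configs V)"
  by (auto simp: spin_configs_def intro!: finite_PiE)

lemma partition_function_pos:
  assumes "finite V"
  shows "partition_function V E \<beta> J > 0"
proof -
  have "(\<lambda>v\<in>V. 1) \<in> spin_configs V"
    by (auto simp: spin_configs_def)
  thus ?thesis
    unfolding partition_function_def
    by (intro sum_pos finite_spin_configs assms) (auto simp: gibbs_weight_def)
qed

lemma pmf_gibbs:
  assumes "finite V"
  shows "pmf (gibbs V E \<beta> J) \<sigma> =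
    (if \<sigma> \<in> spin_configs V then gibbs_weight E \<beta> J \<sigma> / partition_function V E \<beta> J else 0)"
  unfolding gibbs_def
proof (rule pmf_embed_pmf)
  let ?f = "\<lambda>\<sigma>. if \<sigma> \<in> spin_configs V
    then gibbs_weight E \<beta> J \<sigma> / partition_function V E \<beta> J else 0"
  have Z: "partition_function V E \<beta> J > 0"
    by (rule partition_function_pos[OF assms])
  show nonneg: "0 \<le> ?f \<sigma>" for \<sigma>
    using Z by (auto simp: gibbs_weight_def)
  have "(\<integral>\<^sup>+\<sigma>. ennreal (?f \<sigma>) \<partial>count_space UNIV) = (\<Sum>\<sigma>\<in>spin_configs V. ennreal (?f \<sigma>))"
    by (intro nn_integral_count_space' finite_spin_configs assms) auto
  also have "\<dots> = ennreal (\<Sum>\<sigma>\<in>spin_configs V. ?f \<sigma>)"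
    by (rule sum_ennreal) (rule nonneg)
  also have "(\<Sum>\<sigma>\<in>spin_configs V. ?f \<sigma>) = 1"
    using Z by (simp add: sum_divide_distrib[symmetric] partition_function_def)
  finally show "(\<integral>\<^sup>+\<sigma>. ennreal (?f \<sigma>) \<partial>count_space UNIV) = 1"
    by simp
qed

lemma set_pmf_gibbs:
  assumes "finite V"
  shows "set_pmf (gibbs V E \<beta> J) = spin_configs V"
  using partition_function_pos[OF assms, of E \<beta> J]
  by (auto simp: set_pmf_iff pmf_gibbs[OF assms] gibbs_weight_def split: if_splits)

lemma gibbs_root_spin_possible:
  assumes "finite V" "r \<in> V" "s \<in> {-1, 1}"
  shows "set_pmf (gibbs V E \<beta> J) \<inter> {\<sigma>. \<sigma> r = s} \<noteq> {}"
proof -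
  have "(\<lambda>v\<in>V. s) \<in> spin_configs V \<inter> {\<sigma>. \<sigma> r = s}"
    using assms by (auto simp: spin_configs_def)
  thus ?thesis
    by (auto simp: set_pmf_gibbs[OF assms(1)])
qed

lemma tv_dist_eq_half_sum:
  assumes "finite S" "set_pmf p \<subseteq> S" "set_pmf q \<subseteq> S"
  shows "tv_dist p q = (\<Sum>x\<in>S. \<bar>pmf p x - pmf q x\<bar>) / 2"
proof -
  define d where "d x = pmf p x - pmf q x" for x
  have prob: "measure_pmf.prob p A - measure_pmf.prob q A = sum d (A \<inter> S)" for A
  proof -
    have "measure_pmf.prob p A = sum (pmf p) (A \<inter> S)" "measure_pmf.prob q A = sum (pmf q) (A \<inter> S)"
      using assms measure_Int_set_pmf[of p A] measure_Int_set_pmf[of p "A \<inter> S"]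
        measure_Int_set_pmf[of q A] measure_Int_set_pmf[of q "A \<inter> S"]
      by (simp_all add: measure_measure_pmf_finite[symmetric] Int_assoc inf.absorb2)
    thus ?thesis by (simp add: d_def sum_subtractf)
  qed
  have tot: "sum d S = 0"
    using assms by (simp add: d_def sum_subtractf sum_pmf_eq_1)
  define P where "P = {x \<in> S. d x \<ge> 0}"
  have split: "sum f S = sum f P + sum f (S - P)" for f :: "_ \<Rightarrow> real"
    using sum.subset_diff[of P S f] assms(1) by (auto simp: P_def)
  have half: "sum d P = (\<Sum>x\<in>S. \<bar>d x\<bar>) / 2"
  proof -
    have "(\<Sum>x\<in>S. \<bar>d x\<bar>) = sum d P + (\<Sum>x\<in>S-P. - d x)"
      unfolding split[of "\<lambda>x. \<bar>d x\<bar>"]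
      by (intro arg_cong2[of _ _ _ _ "(+)"] sum.cong) (auto simp: P_def)
    thus ?thesis using tot split[of d] by (simp add: sum_negf)
  qed
  have le: "\<bar>sum d (A \<inter> S)\<bar> \<le> (\<Sum>x\<in>S. \<bar>d x\<bar>) / 2" for A
  proof -
    have "sum d S = sum d (A \<inter> S) + sum d (S - A)" "(\<Sum>x\<in>S. \<bar>d x\<bar>) = (\<Sum>x\<in>A \<inter> S. \<bar>d x\<bar>) + (\<Sum>x\<in>S - A. \<bar>d x\<bar>)"
      using assms(1) by (metis sum.Int_Diff inf_commute)+
    moreover have "\<bar>sum d (A \<inter> S)\<bar> \<le> (\<Sum>x\<in>A \<inter> S. \<bar>d x\<bar>)" "\<bar>sum d (S - A)\<bar> \<le> (\<Sum>x\<in>S - A. \<bar>d x\<bar>)"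
      by (rule sum_abs)+
    ultimately show ?thesis using tot by linarith
  qed
  have "(SUP A. \<bar>sum d (A \<inter> S)\<bar>) = (\<Sum>x\<in>S. \<bar>d x\<bar>) / 2"
  proof (rule antisym)
    show "(SUP A. \<bar>sum d (A \<inter> S)\<bar>) \<le> (\<Sum>x\<in>S. \<bar>d x\<bar>) / 2"
      by (rule cSUP_least) (use le in auto)
    have "P \<inter> S = P" by (auto simp: P_def)
    hence "(\<Sum>x\<in>S. \<bar>d x\<bar>) / 2 \<le> \<bar>sum d (P \<inter> S)\<bar>" using half by simp
    also have "\<dots> \<le> (SUP A. \<bar>sum d (A \<inter> S)\<bar>)"
      by (rule cSUP_upper) (auto intro!: bdd_aboveI2[OF le])
    finally show "(\<Sum>x\<in>S. \<bar>d x\<bar>) / 2 \<le> (SUP A. \<bar>sum d (A \<inter> S)\<bar>)" .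
  qed
  thus ?thesis by (simp add: tv_dist_def prob d_def)
qed

end

theory Submission
  imports Defs
begin

text \<open>For pmfs \<open>p\<close>, \<open>q\<close> and every real \<open>c\<close>, summing
  \<open>2 c f (p - q) \<le> \<bar>p - q\<bar> + c\<^sup>2 f\<^sup>2 (p + q)\<close> bounds \<open>c (\<langle>f\<rangle>\<^sub>p - \<langle>f\<rangle>\<^sub>q)\<close> by the total variation
  distance plus \<open>c\<^sup>2\<close> times the second moment of \<open>f\<close> under \<open>(p + q) / 2\<close>. By spin-flip symmetry the
  root spin is unbiased, so for \<open>p = \<mu>\<^sup>+\<close>, \<open>q = \<mu>\<^sup>-\<close> this mixture is the marginal of \<open>\<mu>\<close> itself.
  The bound is linear in the three quantities, hence survives taking expectations over
  the couplings; optimising over the constant \<open>c\<close> afterwards gives the theorem.\<close>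

lemma expectation_diff_le_tv_dist:
  fixes f :: "'a \<Rightarrow> real" and c :: real
  assumes "finite S" "set_pmf p \<subseteq> S" "set_pmf q \<subseteq> S"
  shows "c * (measure_pmf.expectation p f - measure_pmf.expectation q f)
    \<le> tv_dist p q + c\<^sup>2 * ((measure_pmf.expectation p (\<lambda>x. (f x)\<^sup>2)
        + measure_pmf.expectation q (\<lambda>x. (f x)\<^sup>2)) / 2)"
proof -
  have exp: "measure_pmf.expectation p g = (\<Sum>x\<in>S. pmf p x * g x)"
    "measure_pmf.expectation q g = (\<Sum>x\<in>S. pmf q x * g x)" for g :: "'a \<Rightarrow> real"
    using assms by (subst integral_measure_pmf[of S]; auto)+
  have "c * (measure_pmf.expectation p f - measure_pmf.expectation q f)
      = (\<Sum>x\<in>S. c * f x * (pmf p x - pmf q x))"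
    by (simp add: exp sum_subtractf[symmetric] sum_distrib_left algebra_simps)
  also have "\<dots> \<le> (\<Sum>x\<in>S. \<bar>pmf p x - pmf q x\<bar> / 2 + c\<^sup>2 * (pmf p x * (f x)\<^sup>2 + pmf q x * (f x)\<^sup>2) / 2)"
  proof (rule sum_mono)
    fix x
    have amgm: "\<bar>c * f x\<bar> \<le> (1 + (c * f x)\<^sup>2) / 2"
      using zero_le_power2[of "\<bar>c * f x\<bar> - 1"] by (simp add: power2_diff)
    have "c * f x * (pmf p x - pmf q x) \<le> \<bar>c * f x\<bar> * \<bar>pmf p x - pmf q x\<bar>"
      by (metis abs_ge_self abs_mult)
    also have "\<dots> \<le> (1 + (c * f x)\<^sup>2) / 2 * \<bar>pmf p x - pmf q x\<bar>"
      by (intro mult_right_mono amgm) auto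
    also have "\<dots> = \<bar>pmf p x - pmf q x\<bar> / 2 + (c * f x)\<^sup>2 / 2 * \<bar>pmf p x - pmf q x\<bar>"
      by (simp add: field_simps)
    \<comment> \<open>Only the quadratic term is enlarged from the difference to the sum of the two
      masses. The term \<open>\<bar>pmf p x - pmf q x\<bar> / 2\<close> stays, since summing it over
      \<open>S\<close> gives exactly the total variation distance.\<close>
    also have "\<dots> \<le> \<bar>pmf p x - pmf q x\<bar> / 2 + (c * f x)\<^sup>2 / 2 * (pmf p x + pmf q x)"
    proof (intro add_left_mono mult_left_mono)
      show "\<bar>pmf p x - pmf q x\<bar> \<le> pmf p x + pmf q x"
        using pmf_nonneg[of p x] pmf_nonneg[of q x] by linarith
    qed simp
    finally show "c * f x * (pmf p x - pmf q x)
        \<le> \<bar>pmf p x - pmf q x\<bar> / 2 + c\<^sup>2 * (pmf p x * (f x)\<^sup>2 + pmf q x * (f x)\<^sup>2) / 2"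
      by (simp add: field_simps power_mult_distrib)
  qed
  also have "\<dots> = tv_dist p q + c\<^sup>2 * ((measure_pmf.expectation p (\<lambda>x. (f x)\<^sup>2)
        + measure_pmf.expectation q (\<lambda>x. (f x)\<^sup>2)) / 2)"
    by (simp add: exp tv_dist_eq_half_sum[OF assms] sum.distrib[symmetric] sum_distrib_left
        sum_divide_distrib)
  finally show ?thesis .
qed

text \<open>The weight sees only which edges are monochromatic, and negating all spins preserves
  this. Edges lie inside \<open>V\<close>, so the \<open>undefined\<close> values of the restricted
  function never enter.\<close>

lemma gibbs_weight_spin_flip:
  assumes "simple_graph V E"
  shows "gibbs_weight E \<beta> J (\<lambda>v\<in>V. - \<sigma> v) = gibbs_weight E \<beta> J \<sigma>"
proof -
  have "e \<subseteq> V" if "e \<in> E" for e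
    using assms that by (auto simp: simple_graph_def)
  hence "(\<forall>u\<in>e. \<forall>w\<in>e. (\<lambda>v\<in>V. - \<sigma> v) u = (\<lambda>v\<in>V. - \<sigma> v) w) \<longleftrightarrow> (\<forall>u\<in>e. \<forall>w\<in>e. \<sigma> u = \<sigma> w)"
    if "e \<in> E" for e
    using that by (auto simp: subset_iff)
  thus ?thesis
    unfolding gibbs_weight_def by (intro arg_cong[of _ _ exp] arg_cong[of _ _ "(*) \<beta>"] sum.cong) auto
qed

text \<open>The global flip is a weight-preserving bijection between the configurations with root
  spin 1 and those with root spin -1. This holds for each fixed \<open>J\<close>, so the value 1/2
  does not depend on the couplings.\<close>

lemma prob_gibbs_root_spin:
  assumes "simple_graph V E" "r \<in> V" "s \<in> {-1, 1}"
  shows "measure_pmf.prob (gibbs V E \<beta> J) {\<sigma>. \<sigma> r = s} = 1 / 2"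
proof -
  have fin: "finite V" using assms by (simp add: simple_graph_def)
  let ?C = "\<lambda>s. {\<sigma> \<in> spin_configs V. \<sigma> r = s}"
  let ?P = "pmf (gibbs V E \<beta> J)"
  have finC: "finite (?C s)" for s using finite_spin_configs[OF fin] by simp
  have flip: "(\<lambda>v\<in>V. - \<sigma> v) \<in> ?C (-s)" if "\<sigma> \<in> ?C s" for \<sigma> s
    using that assms(2) by (auto simp: spin_configs_def)
  \<comment> \<open>The restricted flip is an involution only on functions that are
    \<open>undefined\<close> outside \<open>V\<close>, as spin configurations are.\<close>
  have flip_flip: "(\<lambda>v\<in>V. - (\<lambda>v\<in>V. - \<sigma> v) v) = \<sigma>" if "\<sigma> \<in> ?C s" for \<sigma> s
    using that by (auto simp: spin_configs_def fun_eq_iff PiE_def extensional_def)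
  have "sum ?P (?C 1) = sum ?P (?C (-1))"
  proof (rule sum.reindex_bij_witness[where i = "\<lambda>\<sigma>. \<lambda>v\<in>V. - \<sigma> v" and j = "\<lambda>\<sigma>. \<lambda>v\<in>V. - \<sigma> v"])
    fix \<sigma> assume s: "\<sigma> \<in> ?C 1"
    show "?P (\<lambda>v\<in>V. - \<sigma> v) = ?P \<sigma>"
      using flip[OF s] s by (simp add: pmf_gibbs[OF fin] gibbs_weight_spin_flip[OF assms(1)])
  qed (use flip[of _ 1] flip[of _ "-1"] flip_flip in simp_all)
  moreover have "sum ?P (?C 1) + sum ?P (?C (-1)) = 1"
  proof -
    have "spin_configs V = ?C 1 \<union> ?C (-1)"
      using assms(2) by (auto simp: spin_configs_def)
    moreover have "?C 1 \<inter> ?C (-1) = {}" by auto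
    ultimately have "sum ?P (?C 1) + sum ?P (?C (-1)) = sum ?P (spin_configs V)"
      using sum.union_disjoint[OF finC finC, of 1 "-1" ?P] by simp
    also have "\<dots> = 1"
      by (intro sum_pmf_eq_1 finite_spin_configs fin) (simp add: set_pmf_gibbs[OF fin])
    finally show ?thesis .
  qed
  ultimately have "sum ?P (?C s) = 1 / 2" using assms(3) by auto
  \<comment> \<open>The event also contains functions that are not spin configurations; intersecting
    with the support leaves a finite set.\<close>
  moreover have "set_pmf (gibbs V E \<beta> J) \<inter> {\<sigma>. \<sigma> r = s} = ?C s"
    by (auto simp: set_pmf_gibbs[OF fin])
  ultimately show ?thesis
    using measure_Int_set_pmf[of "gibbs V E \<beta> J" "{\<sigma>. \<sigma> r = s}"] measure_measure_pmf_finite[OF finC[of s], of "gibbs V E \<beta> J"]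
    by (simp add: Int_commute)
qed

text \<open>Conditioning on an event of probability 1/2 merely doubles the surviving masses. The
  expectation is thus a finite linear combination of Gibbs probabilities whose coefficients are free
  of \<open>J\<close>, which later yields integrability over the couplings.\<close>

lemma expectation_gibbs_cond_marginal:
  fixes f :: "('v \<Rightarrow> int) \<Rightarrow> real"
  assumes "simple_graph V E" "r \<in> V" "s \<in> {-1, 1}"
  shows "measure_pmf.expectation (gibbs_cond_marginal V E \<beta> J r s \<Lambda>) f =
    (\<Sum>\<sigma>\<in>spin_configs V. pmf (gibbs V E \<beta> J) \<sigma> * (2 * of_bool (\<sigma> r = s) * f (restrict \<sigma> \<Lambda>)))"
proof -
  have fin: "finite V" using assms by (simp add: simple_graph_def)
  note ne = gibbs_root_spin_possible[OF fin assms(2,3)]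
  have "measure_pmf.expectation (gibbs_cond_marginal V E \<beta> J r s \<Lambda>) f =
    (\<Sum>\<sigma>\<in>spin_configs V. pmf (cond_pmf (gibbs V E \<beta> J) {\<sigma>. \<sigma> r = s}) \<sigma> * f (restrict \<sigma> \<Lambda>))"
    unfolding gibbs_cond_marginal_def integral_map_pmf
    by (subst integral_measure_pmf[OF finite_spin_configs[OF fin]])
      (auto simp: set_cond_pmf[OF ne] set_pmf_gibbs[OF fin])
  also have "\<dots> = (\<Sum>\<sigma>\<in>spin_configs V.
      pmf (gibbs V E \<beta> J) \<sigma> * (2 * of_bool (\<sigma> r = s) * f (restrict \<sigma> \<Lambda>)))"
    by (intro sum.cong refl) (simp add: pmf_cond[OF ne] prob_gibbs_root_spin[OF assms])
  finally show ?thesis .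
qed

lemma set_pmf_gibbs_cond_marginal:
  assumes "finite V" "r \<in> V" "s \<in> {-1, 1}"
  shows "set_pmf (gibbs_cond_marginal V E \<beta> J r s \<Lambda>) \<subseteq> (\<lambda>\<sigma>. restrict \<sigma> \<Lambda>) ` spin_configs V"
  by (auto simp: gibbs_cond_marginal_def set_cond_pmf[OF gibbs_root_spin_possible[OF assms]]
      set_pmf_gibbs[OF assms(1)])

lemma expectation_gibbs_cond_marginal_average:
  fixes f :: "('v \<Rightarrow> int) \<Rightarrow> real"
  assumes "simple_graph V E" "r \<in> V"
  shows "(measure_pmf.expectation (gibbs_cond_marginal V E \<beta> J r 1 \<Lambda>) f
      + measure_pmf.expectation (gibbs_cond_marginal V E \<beta> J r (-1) \<Lambda>) f) / 2
    = (\<Sum>\<sigma>\<in>spin_configs V. pmf (gibbs V E \<beta> J) \<sigma> * f (restrict \<sigma> \<Lambda>))"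
proof -
  have "\<sigma> r = 1 \<or> \<sigma> r = -1" if "\<sigma> \<in> spin_configs V" for \<sigma>
    using that assms(2) by (auto simp: spin_configs_def)
  hence "of_bool (\<sigma> r = 1) + of_bool (\<sigma> r = -1) = (1 :: real)" if "\<sigma> \<in> spin_configs V" for \<sigma>
    using that by fastforce
  hence "(pmf (gibbs V E \<beta> J) \<sigma> * (2 * of_bool (\<sigma> r = 1) * f (restrict \<sigma> \<Lambda>))
      + pmf (gibbs V E \<beta> J) \<sigma> * (2 * of_bool (\<sigma> r = -1) * f (restrict \<sigma> \<Lambda>))) / 2
    = pmf (gibbs V E \<beta> J) \<sigma> * f (restrict \<sigma> \<Lambda>)" if "\<sigma> \<in> spin_configs V" for \<sigma>
    using that by fastforce
  thus ?thesis
    using assms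
    by (simp add: expectation_gibbs_cond_marginal sum.distrib[symmetric] sum_divide_distrib
        cong: sum.cong)
qed

text \<open>Probabilities are bounded by 1, so measurability is enough and no moment of the
  couplings is required.\<close>

lemma (in finite_measure) integrable_pmf_gibbs:
  assumes "finite V" "\<And>e. e \<in> E \<Longrightarrow> J e \<in> borel_measurable M"
  shows "integrable M (\<lambda>\<omega>. pmf (gibbs V E \<beta> (\<lambda>e. J e \<omega>)) \<sigma>)"
proof (rule integrable_const_bound[where B = 1])
  have [measurable]: "(\<lambda>\<omega>. gibbs_weight E \<beta> (\<lambda>e. J e \<omega>) \<tau>) \<in> borel_measurable M" for \<tau>
    unfolding gibbs_weight_def using assms(2) by measurable
  show "(\<lambda>\<omega>. pmf (gibbs V E \<beta> (\<lambda>e. J e \<omega>)) \<sigma>) \<in> borel_measurable M"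
    unfolding pmf_gibbs[OF assms(1)] partition_function_def by measurable
qed (simp add: pmf_le_1)

theorem theorem9p1:
  fixes h :: nat and V \<Lambda> :: "'v set" and E :: "'v set set" and r :: 'v
    and \<beta> :: real and \<phi> :: "real measure"
    and M :: "'w measure" and J :: "'v set \<Rightarrow> 'w \<Rightarrow> real"
    and G :: "('v \<Rightarrow> int) \<Rightarrow> real"
    and \<mu> :: "'w \<Rightarrow> ('v \<Rightarrow> int) pmf"
    and \<mu>\<Lambda> :: "int \<Rightarrow> 'w \<Rightarrow> ('v \<Rightarrow> int) pmf"
  assumes "h > 0"
    and "rooted_tree V E r"
    and "tree_height V E r = h"
    and "\<Lambda> = tree_level V E r h"
    and "\<beta> > 0"
    and "real_distribution \<phi>"
    and "prob_space M"
    and "prob_space.indep_vars M (\<lambda>_. borel) J E"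
    and "\<And>e. e \<in> E \<Longrightarrow> distr M borel (J e) = \<phi>"
    and "\<And>\<omega>. \<mu> \<omega> = gibbs V E \<beta> (\<lambda>e. J e \<omega>)"
    and "\<And>s \<omega>. \<mu>\<Lambda> s \<omega> = gibbs_cond_marginal V E \<beta> (\<lambda>e. J e \<omega>) r s \<Lambda>"
  shows "(\<integral>\<omega>. tv_dist (\<mu>\<Lambda> 1 \<omega>) (\<mu>\<Lambda> (-1) \<omega>) \<partial>M)
    \<ge> (\<integral>\<omega>. measure_pmf.expectation (\<mu>\<Lambda> 1 \<omega>) G
            - measure_pmf.expectation (\<mu>\<Lambda> (-1) \<omega>) G \<partial>M)\<^sup>2
      / (4 * (\<integral>\<omega>. (\<Sum>\<sigma>\<in>spin_configs V. pmf (\<mu> \<omega>) \<sigma> * (G (restrict \<sigma> \<Lambda>))\<^sup>2) \<partial>M))"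
proof -
  interpret prob_space M by fact
  have graph: "simple_graph V E" and r: "r \<in> V" and fin: "finite V"
    using assms(2) by (auto simp: rooted_tree_def simple_graph_def)
  have meas: "J e \<in> borel_measurable M" if "e \<in> E" for e
    using assms(8) that by (auto simp: indep_vars_def2)
  note [simp] = assms(10,11)
  have int_pmf [simp]: "integrable M (\<lambda>\<omega>. pmf (gibbs V E \<beta> (\<lambda>e. J e \<omega>)) \<sigma>)" for \<sigma>
    by (rule integrable_pmf_gibbs[OF fin meas])
  let ?S = "(\<lambda>\<sigma>. restrict \<sigma> \<Lambda>) ` spin_configs V"
  have finS: "finite ?S" using finite_spin_configs[OF fin] by simp
  note sub = set_pmf_gibbs_cond_marginal[OF fin r]

  let ?T = "\<lambda>\<omega>. tv_dist (\<mu>\<Lambda> 1 \<omega>) (\<mu>\<Lambda> (-1) \<omega>)"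
  let ?D = "\<lambda>\<omega>. measure_pmf.expectation (\<mu>\<Lambda> 1 \<omega>) G - measure_pmf.expectation (\<mu>\<Lambda> (-1) \<omega>) G"
  let ?Q = "\<lambda>\<omega>. \<Sum>\<sigma>\<in>spin_configs V. pmf (\<mu> \<omega>) \<sigma> * (G (restrict \<sigma> \<Lambda>))\<^sup>2"

  have intE: "integrable M (\<lambda>\<omega>. measure_pmf.expectation (\<mu>\<Lambda> s \<omega>) f)"
    if "s \<in> {-1, 1}" for s and f :: "('v \<Rightarrow> int) \<Rightarrow> real"
    using that by (simp add: expectation_gibbs_cond_marginal[OF graph r that])
  have intD: "integrable M ?D"
    by (intro Bochner_Integration.integrable_diff intE) auto
  have intQ: "integrable M ?Q"
    by simp
  \<comment> \<open>Point masses as expectations of indicators let \<open>intE\<close> cover the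
    summands of the total variation distance.\<close>
  have pmf_exp: "pmf p x = measure_pmf.expectation p (indicator {x})" for p :: "('v \<Rightarrow> int) pmf" and x
    by (simp add: measure_pmf_single)
  have intT: "integrable M ?T"
  proof -
    have "?T = (\<lambda>\<omega>. (\<Sum>x\<in>?S. \<bar>pmf (\<mu>\<Lambda> 1 \<omega>) x - pmf (\<mu>\<Lambda> (-1) \<omega>) x\<bar>) / 2)"
      using sub by (intro ext tv_dist_eq_half_sum[OF finS]) auto
    moreover have "integrable M \<dots>"
      unfolding pmf_exp
      by (intro integrable_divide Bochner_Integration.integrable_sum integrable_abs
          Bochner_Integration.integrable_diff intE) auto
    ultimately show ?thesis by simp
  qed

  \<comment> \<open>Here \<open>c\<close> is deterministic, so it leaves the integral; a choice
    depending on \<open>\<omega>\<close> would not give a ratio of expectations.\<close>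
  have key: "c * (\<integral>\<omega>. ?D \<omega> \<partial>M) \<le> (\<integral>\<omega>. ?T \<omega> \<partial>M) + c\<^sup>2 * (\<integral>\<omega>. ?Q \<omega> \<partial>M)" for c
  proof -
    have "c * ?D \<omega> \<le> ?T \<omega> + c\<^sup>2 * ?Q \<omega>" for \<omega>
      using expectation_diff_le_tv_dist[OF finS, of "\<mu>\<Lambda> 1 \<omega>" "\<mu>\<Lambda> (-1) \<omega>" c G] sub
      by (simp add: expectation_gibbs_cond_marginal_average[OF graph r])
    hence "(\<integral>\<omega>. c * ?D \<omega> \<partial>M) \<le> (\<integral>\<omega>. ?T \<omega> + c\<^sup>2 * ?Q \<omega> \<partial>M)"
      by (intro integral_mono integrable_mult_right Bochner_Integration.integrable_add intD intT intQ)
    thus ?thesis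
      using intD intT intQ by (simp only: integral_mult_right_zero Bochner_Integration.integral_add integrable_mult_right)
  qed
  define d q where "d = (\<integral>\<omega>. ?D \<omega> \<partial>M)" and "q = (\<integral>\<omega>. ?Q \<omega> \<partial>M)"
  have "d\<^sup>2 / (4 * q) \<le> (\<integral>\<omega>. ?T \<omega> \<partial>M)"
  proof (cases "q = 0")
    \<comment> \<open>Division by zero yields 0, so the claim is that the expected distance is
      nonnegative, which is \<open>key\<close> at 0.\<close>
    case True
    thus ?thesis using key[of 0] by simp
  next
    case False
    \<comment> \<open>The quadratic \<open>c * d - c\<^sup>2 * q\<close> is largest at
      \<open>c = d / (2 * q)\<close>, and its value there produces the factor 4.\<close>
    have "d / (2 * q) * d - (d / (2 * q))\<^sup>2 * q = d\<^sup>2 / (4 * q)"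
      using False by (simp add: field_simps power2_eq_square)
    thus ?thesis
      using key[of "d / (2 * q)"] unfolding d_def[symmetric] q_def[symmetric] by linarith
  qed
  thus ?thesis unfolding d_def q_def .
qed

end
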